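(* Let $A[1,N]$ be an array of mutually distinct elements of a totally ordered set and let $\overleftrightarrow{A}:=[A[N],\ldots,A[1]]$ be its reversal. Then $(T[A])^*=T[\overleftrightarrow{A}]$, where nodes of both trees are identified via the array entries (the node $A[i]$ of $T[A]$ is identified with the node of $T[\overleftrightarrow{A}]$ carrying the same entry) and the roots are identified.
   Context: The 2D-Min-Heap $T[A]$ of an array $A[1,N]$ with distinct entries is the rooted ordered tree with node set $\{r\}\cup\{A[1],\ldots,A[N]\}$ (the root $r$ playing the role of $-\infty$), built by inserting $A[1],A[2],\ldots,A[N]$ in this order: $A[m+1]$ is appended as the new rightmost child of $A[k]$, where $k$ is the largest index $k\le m$ with $A[k]<A[m+1]$, or as the new rightmost child of $r$ if no such index exists (in particular $A[1]$ is a child of $r$). Dual tree: for a rooted ordered tree $T$ with root $r$, $T^*$ has the same vertex set and root $r$; with $rmc_T(u)$ the rightmost child and $ils_T(u)$ the immediate left sibling of $u$ in $T$, parents and sibling order in $T^*$ are given by: (1a) $r$ has no parent in $T^*$; (1b) if $v=rmc_T(r)$ then $v$ is the rightmost child of $r$ in $T^*$; (2) if $v=rmc_T(u)$ with $u\ne r$, then $v$ is the immediate left sibling of $u$ in $T^*$; (3) if $v=ils_T(u)$, then $v$ is the rightmost child of $u$ in $T^*$. Equality of trees means equal parent relation and equal order among siblings. *)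

theory Defs
  imports Main
begin

section \<open>Rooted ordered trees\<close>

text \<open>
  A tree is given by its vertex set, its root and, for every vertex, the list of its children from
  left to right. Equality of such records is equality of vertex sets, roots, parent
  relations and sibling orders (see \<open>ordered_tree_eqI\<close>).
\<close>

record 'v otree =
  verts :: "'v set"
  root :: 'v
  children :: "'v \<Rightarrow> 'v list"

definition edges :: "'v otree \<Rightarrow> ('v \<times> 'v) set" where
  "edges T = {(u, v). v \<in> set (children T u)}"

text \<open>The condition on \<open>u \<notin> verts T\<close> only fixes the junk values of \<open>children T\<close>.\<close>

definition ordered_tree :: "'v otree \<Rightarrow> bool" where
  "ordered_tree T \<longleftrightarrow>
     finite (verts T) \<and> root T \<in> verts T \<and>
     (\<forall>u. u \<notin> verts T \<longrightarrow> children T u = []) \<and>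
     (\<forall>u. distinct (children T u) \<and> set (children T u) \<subseteq> verts T) \<and>
     (\<forall>u. root T \<notin> set (children T u)) \<and>
     (\<forall>v \<in> verts T - {root T}. \<exists>!u. v \<in> set (children T u)) \<and>
     (\<forall>v \<in> verts T. (root T, v) \<in> (edges T)\<^sup>*)"

text \<open>\<open>rmc T u v\<close>: \<open>v\<close> is the rightmost child of \<open>u\<close>;
  \<open>ils T u v\<close>: \<open>v\<close> is the immediate left sibling of \<open>u\<close>.\<close>

definition rmc :: "'v otree \<Rightarrow> 'v \<Rightarrow> 'v \<Rightarrow> bool" where
  "rmc T u v \<longleftrightarrow> children T u \<noteq> [] \<and> v = last (children T u)"

definition ils :: "'v otree \<Rightarrow> 'v \<Rightarrow> 'v \<Rightarrow> bool" where
  "ils T u v \<longleftrightarrow> (\<exists>w xs ys. children T w = xs @ v # u # ys)"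

section \<open>The dual tree\<close>

text \<open>That the root has no parent in the dual is part of \<open>ordered_tree T'\<close>.\<close>

definition is_dual :: "'v otree \<Rightarrow> 'v otree \<Rightarrow> bool" where
  "is_dual T T' \<longleftrightarrow>
     ordered_tree T' \<and> verts T' = verts T \<and> root T' = root T \<and>
     (\<forall>v. rmc T (root T) v \<longrightarrow> rmc T' (root T) v) \<and>
     (\<forall>u v. u \<noteq> root T \<and> rmc T u v \<longrightarrow> ils T' u v) \<and>
     (\<forall>u v. ils T u v \<longrightarrow> rmc T' u v)"

text \<open>The description is justified by \<open>ex1_is_dual\<close> below.\<close>

definition dual :: "'v otree \<Rightarrow> 'v otree" where
  "dual T = (THE T'. is_dual T T')"

section \<open>The 2D-Min-Heap of an array\<close>

text \<open>
  Arrays are lists, so indices start at 0. The vertex \<open>Some x\<close> is the array entry \<open>x\<close>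
  and \<open>None\<close> is the additional root.
\<close>

definition attach_point :: "'a::linorder list \<Rightarrow> nat \<Rightarrow> 'a option" where
  "attach_point A m =
     (if \<exists>k<m. A ! k < A ! m then Some (A ! (GREATEST k. k < m \<and> A ! k < A ! m)) else None)"

definition append_child :: "'v otree \<Rightarrow> 'v \<Rightarrow> 'v \<Rightarrow> 'v otree" where
  "append_child T u v =
     T\<lparr>verts := insert v (verts T), children := (children T)(u := children T u @ [v])\<rparr>"

primrec heap_upto :: "'a::linorder list \<Rightarrow> nat \<Rightarrow> 'a option otree" where
  "heap_upto A 0 = \<lparr>verts = {None}, root = None, children = \<lambda>_. []\<rparr>"
| "heap_upto A (Suc m) = append_child (heap_upto A m) (attach_point A m) (Some (A ! m))"

definition min_heap :: "'a::linorder list \<Rightarrow> 'a option otree" where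
  "min_heap A = heap_upto A (length A)"

section \<open>Well-definedness of the dual\<close>

lemma ordered_treeD:
  assumes "ordered_tree T"
  shows "finite (verts T)" "root T \<in> verts T"
    and "u \<notin> verts T \<Longrightarrow> children T u = []"
    and "distinct (children T u)"
    and "v \<in> set (children T u) \<Longrightarrow> v \<in> verts T \<and> v \<noteq> root T \<and> u \<in> verts T"
    and "v \<in> set (children T u) \<Longrightarrow> v \<in> set (children T u') \<Longrightarrow> u = u'"
    and "v \<in> verts T \<Longrightarrow> v \<noteq> root T \<Longrightarrow> \<exists>u. v \<in> set (children T u)"
    and "v \<in> verts T \<Longrightarrow> (root T, v) \<in> (edges T)\<^sup>*"
proof -
  note T = assms[unfolded ordered_tree_def]
  show "finite (verts T)" "root T \<in> verts T" "distinct (children T u)"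
    using T by blast+
  show "u \<notin> verts T \<Longrightarrow> children T u = []" using T by blast
  show c: "v \<in> set (children T u) \<Longrightarrow> v \<in> verts T \<and> v \<noteq> root T \<and> u \<in> verts T" for u
    using T by (metis emptyE list.set(1) subsetD)
  show "v \<in> set (children T u) \<Longrightarrow> v \<in> set (children T u') \<Longrightarrow> u = u'"
    using T c by (metis DiffI singletonD)
  show "v \<in> verts T \<Longrightarrow> v \<noteq> root T \<Longrightarrow> \<exists>u. v \<in> set (children T u)" using T by blast
  show "v \<in> verts T \<Longrightarrow> (root T, v) \<in> (edges T)\<^sup>*" using T by blast
qed

lemma distinct_order_eqI:
  assumes "distinct l" "distinct l'" "set l = set l'"
    and "\<And>v w. (\<exists>xs ys zs. l = xs @ v # ys @ w # zs) \<longleftrightarrow> (\<exists>xs ys zs. l' = xs @ v # ys @ w # zs)"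
  shows "l = l'"
  using assms
proof (induction l arbitrary: l')
  case Nil
  then show ?case by simp
next
  case (Cons a l)
  from Cons.prems(3) obtain b l'' where l': "l' = b # l''" by (cases l') auto
  have "a = b"
  proof (rule ccontr)
    assume ab: "a \<noteq> b"
    have "b \<in> set l" using Cons.prems(3) l' ab by auto
    then obtain p q where pq: "l = p @ b # q" by (meson split_list)
    have "\<exists>xs ys zs. a # l = xs @ a # ys @ b # zs"
      by (rule exI[of _ "[]"]) (use pq in auto)
    then obtain xs ys zs where "l' = xs @ a # ys @ b # zs" using Cons.prems(4) by blast
    then show False using l' ab Cons.prems(2) by (cases xs) auto
  qed
  moreover have "l = l''"
  proof (rule Cons.IH)
    show "distinct l" "distinct l''" using Cons.prems l' by auto
    show "set l = set l''" using Cons.prems(1-3) l' \<open>a = b\<close> by auto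
    have aux: "(\<exists>xs ys zs. k = xs @ v # ys @ w # zs) \<longleftrightarrow>
        v \<noteq> a \<and> (\<exists>xs ys zs. a # k = xs @ v # ys @ w # zs)"
      if "distinct (a # k)" for k v w
    proof
      assume "\<exists>xs ys zs. k = xs @ v # ys @ w # zs"
      then obtain xs ys zs where k: "k = xs @ v # ys @ w # zs" by blast
      then have "a # k = (a # xs) @ v # ys @ w # zs" by simp
      moreover have "v \<noteq> a" using that k by auto
      ultimately show "v \<noteq> a \<and> (\<exists>xs ys zs. a # k = xs @ v # ys @ w # zs)" by blast
    next
      assume "v \<noteq> a \<and> (\<exists>xs ys zs. a # k = xs @ v # ys @ w # zs)"
      then obtain xs ys zs where "v \<noteq> a" "a # k = xs @ v # ys @ w # zs" by blast
      then show "\<exists>xs ys zs. k = xs @ v # ys @ w # zs" by (cases xs) auto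
    qed
    have "distinct (a # l'')" using Cons.prems(2) l' \<open>a = b\<close> by simp
    then show "(\<exists>xs ys zs. l = xs @ v # ys @ w # zs) \<longleftrightarrow> (\<exists>xs ys zs. l'' = xs @ v # ys @ w # zs)"
      for v w
      using aux[OF Cons.prems(1)] aux[of l''] Cons.prems(4) l' \<open>a = b\<close> by simp
  qed
  ultimately show ?case using l' by simp
qed

lemma ordered_tree_eqI:
  assumes "ordered_tree (T :: 'v otree)" "ordered_tree T'"
    and "verts T = verts T'" "root T = root T'"
    and "\<And>u v. v \<in> set (children T u) \<longleftrightarrow> v \<in> set (children T' u)"
    and "\<And>u v w. (\<exists>xs ys zs. children T u = xs @ v # ys @ w # zs) \<longleftrightarrow>
                  (\<exists>xs ys zs. children T' u = xs @ v # ys @ w # zs)"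
  shows "T = T'"
proof -
  have "children T u = children T' u" for u
    using assms(5,6) ordered_treeD(4)[OF assms(1)] ordered_treeD(4)[OF assms(2)]
    by (intro distinct_order_eqI) auto
  then have "children T = children T'" by blast
  then show ?thesis using assms(3,4) by (intro otree.equality) auto
qed

lemma rmc_children: "rmc T u v \<Longrightarrow> v \<in> set (children T u)"
  by (auto simp: rmc_def)

lemma ils_child:
  "ils T u v \<Longrightarrow> \<exists>w xs ys. children T w = xs @ v # u # ys \<and>
     u \<in> set (children T w) \<and> v \<in> set (children T w)"
  unfolding ils_def by fastforce

lemma rmc_or_ils:
  assumes "v \<in> set (children T u)"
  shows "rmc T u v \<or> (\<exists>w. ils T w v)"
proof -
  obtain xs ys where c: "children T u = xs @ v # ys" using assms by (meson split_list)
  show ?thesis by (cases ys) (use c in \<open>auto simp: rmc_def ils_def\<close>)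
qed

lemma rmc_not_ils:
  assumes "ordered_tree T" "rmc T u v" "ils T w v"
  shows False
proof -
  obtain p xs ys where p: "children T p = xs @ v # w # ys" "v \<in> set (children T p)"
    using ils_child[OF assms(3)] by blast
  have "p = u" using ordered_treeD(6)[OF assms(1) p(2) rmc_children[OF assms(2)]] .
  then show False
    using p(1) assms(2) ordered_treeD(4)[OF assms(1), of u]
    by (auto simp: rmc_def split: if_splits)
qed

lemma rmc_unique:
  assumes "ordered_tree T" "rmc T u v" "rmc T u' v"
  shows "u = u'"
  using ordered_treeD(6)[OF assms(1)] assms(2,3) rmc_children by metis

lemma ils_unique:
  assumes "ordered_tree T" "ils T u v" "ils T u' v"
  shows "u = u'"
proof -
  obtain p xs ys where p: "children T p = xs @ v # u # ys" "v \<in> set (children T p)"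
    using ils_child[OF assms(2)] by blast
  obtain q xs' ys' where q: "children T q = xs' @ v # u' # ys'" "v \<in> set (children T q)"
    using ils_child[OF assms(3)] by blast
  have "p = q" using ordered_treeD(6)[OF assms(1) p(2) q(2)] .
  then have "xs @ v # u # ys = xs' @ v # u' # ys'" using p q by simp
  moreover have "distinct (xs @ v # u # ys)" using ordered_treeD(4)[OF assms(1), of p] p by simp
  ultimately show ?thesis by (auto simp: append_eq_append_conv2 append_eq_Cons_conv Cons_eq_append_conv)
qed

lemma ils_unique':
  assumes "ordered_tree T" "ils T u v" "ils T u v'"
  shows "v = v'"
proof -
  obtain p xs ys where p: "children T p = xs @ v # u # ys" "u \<in> set (children T p)"
    using ils_child[OF assms(2)] by blast
  obtain q xs' ys' where q: "children T q = xs' @ v' # u # ys'" "u \<in> set (children T q)"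
    using ils_child[OF assms(3)] by blast
  have "p = q" using ordered_treeD(6)[OF assms(1) p(2) q(2)] .
  then have "xs @ v # u # ys = xs' @ v' # u # ys'" using p q by simp
  moreover have "distinct (xs @ v # u # ys)" using ordered_treeD(4)[OF assms(1), of p] p by simp
  ultimately show ?thesis by (auto simp: append_eq_append_conv2 append_eq_Cons_conv Cons_eq_append_conv)
qed

lemma rmc_ils_determine:
  assumes T: "ordered_tree (T :: 'v otree)" and T': "ordered_tree T'"
    and "verts T = verts T'" "root T = root T'"
    and r: "\<And>u v. rmc T u v \<longleftrightarrow> rmc T' u v" and i: "\<And>u v. ils T u v \<longleftrightarrow> ils T' u v"
  shows "T = T'"
proof -
  have suf: "\<exists>ws. children S' u = ws @ zs"
    if S': "ordered_tree S'" and "\<And>u v. rmc S u v \<Longrightarrow> rmc S' u v"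
      and "\<And>u v. ils S u v \<Longrightarrow> ils S' u v" and "children S u = ws @ zs"
    for S S' :: "'v otree" and u zs ws
    using that(4)
  proof (induction zs arbitrary: ws)
    case Nil
    then show ?case by simp
  next
    case (Cons x zs)
    show ?case
    proof (cases zs)
      case Nil
      then have "rmc S u x" using Cons.prems by (simp add: rmc_def)
      then have "rmc S' u x" using that(2) by blast
      then show ?thesis using Nil unfolding rmc_def by (metis append_butlast_last_id)
    next
      case (Cons y zs')
      obtain ws' where ws': "children S' u = ws' @ y # zs'"
        using Cons.IH[of "ws @ [x]"] Cons.prems Cons by auto
      have "ils S y x" using Cons.prems Cons unfolding ils_def by blast
      then have "ils S' y x" using that(3) by blast
      then obtain w p q where w: "children S' w = p @ x # y # q" "y \<in> set (children S' w)"
        using ils_child by metis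
      have "w = u" using ordered_treeD(6)[OF S' w(2), of u] ws' by simp
      then have "ws' @ y # zs' = (p @ [x]) @ y # q" using w ws' by simp
      moreover have "distinct (ws' @ y # zs')" using ordered_treeD(4)[OF S', of u] ws' by simp
      ultimately have "ws' = p @ [x]"
        by (auto simp: append_eq_append_conv2 append_eq_Cons_conv Cons_eq_append_conv)
      then show ?thesis using ws' Cons by simp
    qed
  qed
  have "children T u = children T' u" for u
  proof -
    obtain a where a: "children T' u = a @ children T u"
      using suf[OF T', of T u "[]"] r i by auto
    obtain b where "children T u = b @ children T' u"
      using suf[OF T, of T' u "[]"] r i by auto
    then show ?thesis using a by simp
  qed
  then have "children T = children T'" by blast
  then show ?thesis using assms(3,4) by (intro otree.equality) auto
qed

lemma is_dual_iff:
  assumes T: "ordered_tree T" and D: "is_dual T T'"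
  shows "rmc T' u v \<longleftrightarrow> (u = root T \<and> rmc T u v) \<or> ils T u v" (is ?A)
    and "ils T' u v \<longleftrightarrow> u \<noteq> root T \<and> rmc T u v" (is ?B)
proof -
  have T': "ordered_tree T'" and V: "verts T' = verts T" "root T' = root T"
    and 1: "\<And>v. rmc T (root T) v \<Longrightarrow> rmc T' (root T) v"
    and 2: "\<And>u v. u \<noteq> root T \<Longrightarrow> rmc T u v \<Longrightarrow> ils T' u v"
    and 3: "\<And>u v. ils T u v \<Longrightarrow> rmc T' u v"
    using D unfolding is_dual_def by blast+
  have cases: "rmc T (root T) v \<or> (\<exists>p. p \<noteq> root T \<and> rmc T p v) \<or> (\<exists>y. ils T y v)"
    if "v \<in> set (children T' q)" for q
  proof -
    have "v \<in> verts T" "v \<noteq> root T" using ordered_treeD(5)[OF T' that] V by auto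
    then obtain p where "v \<in> set (children T p)" using ordered_treeD(7)[OF T] by blast
    then show ?thesis using rmc_or_ils by metis
  qed
  have "(u = root T \<and> rmc T u v) \<or> ils T u v" if "rmc T' u v"
    using cases[OF rmc_children[OF that]] 1 2 3 rmc_unique[OF T' that] rmc_not_ils[OF T' that]
    by metis
  then show ?A using 1 3 by blast
  have "u \<noteq> root T \<and> rmc T u v" if i: "ils T' u v"
  proof -
    obtain q where "v \<in> set (children T' q)" using ils_child[OF i] by blast
    from cases[OF this] show ?thesis
      using 1 2 3 ils_unique[OF T' i] rmc_not_ils[OF T' _ i] by metis
  qed
  then show ?B using 2 by blast
qed

lemma is_dual_unique:
  assumes "ordered_tree T" "is_dual T T'" "is_dual T T''"
  shows "T' = T''"
proof (rule rmc_ils_determine)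
  show "ordered_tree T'" "ordered_tree T''" "verts T' = verts T''" "root T' = root T''"
    using assms(2,3) unfolding is_dual_def by auto
  show "rmc T' u v \<longleftrightarrow> rmc T'' u v" "ils T' u v \<longleftrightarrow> ils T'' u v" for u v
    using is_dual_iff[OF assms(1,2)] is_dual_iff[OF assms(1,3)] by simp_all
qed

lemma wf_edges:
  assumes T: "ordered_tree T"
  shows "wf ((edges T)\<inverse>)"
proof (rule finite_acyclic_wf_converse)
  have "edges T \<subseteq> verts T \<times> verts T"
    using ordered_treeD(5)[OF T] unfolding edges_def by auto
  then show "finite (edges T)"
    using ordered_treeD(1)[OF T] finite_subset by blast
  have nc: "(v, v) \<notin> (edges T)\<^sup>+" if "(root T, v) \<in> (edges T)\<^sup>*" for v
    using that
  proof (induction rule: rtrancl_induct)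
    case base
    show ?case
    proof
      assume "(root T, root T) \<in> (edges T)\<^sup>+"
      then obtain p where "(p, root T) \<in> edges T" by (meson tranclE)
      then show False using ordered_treeD(5)[OF T] unfolding edges_def by blast
    qed
  next
    case (step y z)
    show ?case
    proof
      assume "(z, z) \<in> (edges T)\<^sup>+"
      then obtain p where p: "(z, p) \<in> (edges T)\<^sup>*" "(p, z) \<in> edges T" by (meson tranclD2)
      have "p = y" using p(2) step(2) ordered_treeD(6)[OF T] unfolding edges_def by blast
      then show False using p(1) step(2,3) by (meson rtrancl_into_trancl2)
    qed
  qed
  show "acyclic (edges T)"
    unfolding acyclic_def
  proof (intro allI notI)
    fix v assume v: "(v, v) \<in> (edges T)\<^sup>+"
    then obtain p where "(p, v) \<in> edges T" by (meson tranclE)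
    then have "v \<in> verts T" using ordered_treeD(5)[OF T] unfolding edges_def by blast
    then show False using nc ordered_treeD(8)[OF T] v by blast
  qed
qed

text \<open>The children of a vertex in the dual form a path of rightmost children, read backwards.\<close>

lemma ex_chain:
  assumes T: "ordered_tree T"
  shows "\<exists>ch. \<forall>u. ch u = (if children T u = [] then [u] else ch (last (children T u)) @ [u])"
proof -
  define F where "F f u = (if children T u = [] then [u] else f (last (children T u)) @ [u])"
    for f :: "'a \<Rightarrow> 'a list" and u
  have "adm_wf ((edges T)\<inverse>) F"
    unfolding adm_wf_def F_def edges_def by auto
  then have "wfrec ((edges T)\<inverse>) F u = F (wfrec ((edges T)\<inverse>) F) u" for u
    using wfrec_fixpoint[OF wf_edges[OF T]] by metis
  then show ?thesis unfolding F_def by blast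
qed

lemma is_dual_exists:
  assumes T: "ordered_tree T"
  shows "\<exists>T'. is_dual T T'"
proof -
  obtain ch where ch:
    "\<And>u. ch u = (if children T u = [] then [u] else ch (last (children T u)) @ [u])"
    using ex_chain[OF T] by blast
  define M where "M = {(u, v). rmc T u v}"
  have ME: "(u, v) \<in> M \<Longrightarrow> v \<in> verts T \<and> v \<noteq> root T" for u v
    unfolding M_def using ordered_treeD(5)[OF T] rmc_children by (metis case_prodD mem_Collect_eq)
  have ch1: "ch u = [u] \<and> (\<nexists>v. rmc T u v) \<or> (\<exists>v. rmc T u v \<and> ch u = ch v @ [u])" for u
    using ch[of u] by (auto simp: rmc_def)
  have wfM: "wf (M\<inverse>)"
    by (rule wf_subset[OF wf_edges[OF T]]) (auto simp: M_def edges_def rmc_children)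
  have ch_facts: "set (ch u) = {w. (u, w) \<in> M\<^sup>*} \<and> distinct (ch u) \<and> (\<exists>xs. ch u = xs @ [u]) \<and>
      (\<forall>w v. w \<in> set (ch u) \<and> rmc T w v \<longrightarrow> (\<exists>xs ys. ch u = xs @ v # w # ys))" for u
  proof (induction u rule: wf_induct_rule[OF wfM])
    case (1 u)
    show ?case
    proof (cases "\<exists>v. rmc T u v")
      case False
      then have c: "ch u = [u]" using ch1[of u] by blast
      have "(u, w) \<in> M\<^sup>* \<longleftrightarrow> w = u" for w
        using False unfolding M_def by (auto elim: converse_rtranclE)
      then show ?thesis using c False by auto
    next
      case True
      then obtain v where v: "rmc T u v" "ch u = ch v @ [u]" using ch1[of u] by blast
      have uv: "(u, v) \<in> M" using v by (simp add: M_def)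
      have v': "rmc T u w \<Longrightarrow> w = v" for w using v by (simp add: rmc_def)
      note IH = 1[of v, simplified, OF uv]
      have M: "(u, w) \<in> M\<^sup>* \<longleftrightarrow> w = u \<or> (v, w) \<in> M\<^sup>*" for w
        using uv v' unfolding M_def
        by (metis (no_types, lifting) case_prodD converse_rtranclE converse_rtrancl_into_rtrancl
            mem_Collect_eq rtrancl.rtrancl_refl)
      have "(v, u) \<notin> M\<^sup>*"
      proof
        assume "(v, u) \<in> M\<^sup>*"
        then have "(u, u) \<in> M\<^sup>+" using uv by (meson rtrancl_into_trancl2)
        then show False using wf_acyclic[OF wfM] acyclic_converse[of M] by (simp add: acyclic_def)
      qed
      moreover obtain xs where xs: "ch v = xs @ [v]" using IH by blast
      moreover have "\<exists>xs ys. ch u = xs @ y # w # ys" if w: "w \<in> set (ch u)" "rmc T w y" for w y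
      proof (cases "w = u")
        case True
        then have "y = v" using v' w(2) by blast
        then have "ch u = xs @ y # w # []" using v(2) xs True by simp
        then show ?thesis by blast
      next
        case False
        then have "w \<in> set (ch v)" using w(1) v(2) by simp
        then obtain xs ys where "ch v = xs @ y # w # ys" using IH w(2) by blast
        then have "ch u = xs @ y # w # (ys @ [u])" using v(2) by simp
        then show ?thesis by blast
      qed
      moreover have "set (ch u) = {w. (u, w) \<in> M\<^sup>*}"
        using IH M v(2) by auto
      moreover have "distinct (ch u)"
        using IH v(2) \<open>(v, u) \<notin> M\<^sup>*\<close> by simp
      ultimately show ?thesis using v(2) by blast
    qed
  qed
  define top where "top u v \<longleftrightarrow> (u = root T \<and> rmc T u v) \<or> ils T u v" for u v
  have ils_facts: "u \<in> verts T \<and> v \<in> verts T \<and> u \<noteq> root T \<and> v \<noteq> root T" if "ils T u v" for u v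
    using ils_child[OF that] ordered_treeD(5)[OF T] by metis
  have top_fun: "v = v'" if "top u v" "top u v'" for u v v'
    using that ils_facts ils_unique'[OF T] unfolding top_def rmc_def by metis
  have top_inj: "u = u'" if "top u v" "top u' v" for u u' v
    using that ils_unique[OF T] rmc_not_ils[OF T] unfolding top_def by metis
  have top_verts: "u \<in> verts T \<and> v \<in> verts T \<and> v \<noteq> root T" if "top u v" for u v
    using that ils_facts ordered_treeD(2,5)[OF T] rmc_children unfolding top_def by metis
  have top_top: "rmc T p v \<Longrightarrow> p = root T" if "top u v" for u v p
    using that rmc_unique[OF T] rmc_not_ils[OF T] unfolding top_def by metis
  define c where "c u = (if \<exists>v. top u v then ch (THE v. top u v) else [])" for u
  have c_top: "c u = ch v" if "top u v" for u v
  proof -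
    have "(THE v. top u v) = v" using that top_fun by blast
    then show ?thesis using that unfolding c_def by auto
  qed
  have c_set: "w \<in> set (c u) \<longleftrightarrow> (\<exists>v. top u v \<and> (v, w) \<in> M\<^sup>*)" for u w
  proof (cases "\<exists>v. top u v")
    case True
    then obtain v where v: "top u v" by blast
    then show ?thesis using c_top[OF v] ch_facts[of v] top_fun by auto
  next
    case False
    then show ?thesis by (simp add: c_def)
  qed
  have path_verts: "w \<in> verts T \<and> w \<noteq> root T" if "top u v" "(v, w) \<in> M\<^sup>*" for u v w
    using that(2) top_verts[OF that(1)] ME by (cases rule: rtranclE) auto
  have M_inj: "p = q" if "(p, w) \<in> M" "(q, w) \<in> M" for p q w
    using that rmc_unique[OF T] unfolding M_def by blast
  have path_unique: "v = v'" if "top u v" "top u' v'" "(v, w) \<in> M\<^sup>*" "(v', w) \<in> M\<^sup>*" for u u' v v' w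
    using that(3,4)
  proof (induction rule: rtrancl_induct)
    case base
    show ?case
      using base
    proof (cases rule: rtranclE)
      case (step p)
      then have "p = root T" using top_top[OF that(1)] by (auto simp: M_def)
      then show ?thesis using path_verts[OF that(2) step(1)] by simp
    qed auto
  next
    case (step y z)
    show ?case
      using step(4)
    proof (cases rule: rtranclE)
      case base
      then have "y = root T" using top_top[OF that(2)] step(2) by (auto simp: M_def)
      then show ?thesis using path_verts[OF that(1) step(1)] by simp
    next
      case (step p)
      then show ?thesis using M_inj \<open>(y, z) \<in> M\<close> \<open>(v', y) \<in> M\<^sup>* \<Longrightarrow> v = v'\<close> by blast
    qed
  qed
  have c_unique: "u = u'" if "w \<in> set (c u)" "w \<in> set (c u')" for u u' w
    using that c_set path_unique top_inj by metis
  define T' where "T' = \<lparr>verts = verts T, root = root T, children = c\<rparr>"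
  have rmcI: "rmc T' u v" if "top u v" for u v
    using c_top[OF that] ch_facts[of v] by (auto simp: rmc_def T'_def)
  have ilsI: "\<exists>xs ys. c q = xs @ v # u # ys" if u: "rmc T u v" "u \<in> set (c q)" for u v q
  proof -
    obtain t where "top q t" using u(2) c_set by blast
    then show ?thesis using c_top[of q t] ch_facts[of t] u by auto
  qed
  have reach: "(root T, w) \<in> (edges T')\<^sup>*" if "(root T, w) \<in> (edges T)\<^sup>*" for w
    using that
  proof (induction rule: rtrancl_induct)
    case base
    show ?case by simp
  next
    case (step y z)
    have lastc: "(root T, v) \<in> (edges T')\<^sup>*" if v: "rmc T y v" for v
    proof (cases "y = root T")
      case True
      then have "rmc T' (root T) v" using rmcI v by (simp add: top_def)
      then show ?thesis using rmc_children unfolding edges_def by fastforce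
    next
      case False
      obtain q where q: "(root T, q) \<in> (edges T')\<^sup>*" "(q, y) \<in> edges T'"
        using step.IH False by (metis rtranclE)
      then have "y \<in> set (c q)" by (simp add: edges_def T'_def)
      then obtain xs ys where "c q = xs @ v # y # ys" using ilsI[OF v] by blast
      then have "(q, v) \<in> edges T'" by (simp add: edges_def T'_def)
      then show ?thesis using q(1) by (meson rtrancl_into_rtrancl)
    qed
    have "\<forall>v \<in> set zs. (root T, v) \<in> (edges T')\<^sup>*" if "children T y = ws @ zs" for ws zs
      using that
    proof (induction zs arbitrary: ws)
      case Nil
      then show ?case by simp
    next
      case (Cons x zs)
      have IH: "\<forall>v \<in> set zs. (root T, v) \<in> (edges T')\<^sup>*"
        using Cons.IH[of "ws @ [x]"] Cons.prems by simp
      have "(root T, x) \<in> (edges T')\<^sup>*"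
      proof (cases zs)
        case Nil
        then show ?thesis using lastc Cons.prems by (simp add: rmc_def)
      next
        case (Cons b zs')
        then have "ils T b x" using \<open>children T y = ws @ x # zs\<close> unfolding ils_def by blast
        then have "rmc T' b x" using rmcI by (simp add: top_def)
        then have "(b, x) \<in> edges T'" using rmc_children[of T' b x] by (simp add: edges_def)
        then show ?thesis using IH Cons by (meson list.set_intros(1) rtrancl_into_rtrancl)
      qed
      then show ?case using IH by simp
    qed
    from this[of "[]"] show ?case using step(2) by (simp add: edges_def)
  qed
  have par: "\<exists>u. w \<in> set (c u)" if w: "w \<in> verts T" "w \<noteq> root T" for w
  proof -
    have "(root T, w) \<in> (edges T')\<^sup>*" using reach ordered_treeD(8)[OF T w(1)] by blast
    then show ?thesis using w(2) by (cases rule: rtranclE) (auto simp: edges_def T'_def)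
  qed
  have "ordered_tree T'"
    unfolding ordered_tree_def
  proof (intro conjI allI ballI impI)
    show "finite (verts T')" "root T' \<in> verts T'"
      using ordered_treeD(1,2)[OF T] by (simp_all add: T'_def)
    show "children T' u = []" if "u \<notin> verts T'" for u
      using that top_verts unfolding T'_def c_def by auto
    show "distinct (children T' u)" for u
      using ch_facts unfolding T'_def c_def by simp
    show "set (children T' u) \<subseteq> verts T'" for u
      using c_set path_verts unfolding T'_def by auto
    show "root T' \<notin> set (children T' u)" for u
      using c_set[of "root T" u] path_verts[of u _ "root T"] unfolding T'_def by auto
    show "\<exists>!u. v \<in> set (children T' u)" if v: "v \<in> verts T' - {root T'}" for v
    proof -
      obtain u where "v \<in> set (c u)" using v par by (auto simp: T'_def)
      then show ?thesis using c_unique unfolding T'_def by auto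
    qed
    show "(root T', v) \<in> (edges T')\<^sup>*" if "v \<in> verts T'" for v
      using that reach ordered_treeD(8)[OF T] by (simp add: T'_def)
  qed
  moreover have "ils T' u v" if u: "u \<noteq> root T" "rmc T u v" for u v
  proof -
    have "u \<in> verts T" using u(2) rmc_children ordered_treeD(5)[OF T] by metis
    then obtain q where "u \<in> set (c q)" using par u(1) by blast
    then show ?thesis using ilsI[OF u(2)] unfolding ils_def T'_def by fastforce
  qed
  ultimately have "is_dual T T'"
    using rmcI unfolding is_dual_def by (simp add: T'_def top_def)
  then show ?thesis by blast
qed

lemma ex1_is_dual: "ordered_tree T \<Longrightarrow> \<exists>!T'. is_dual T T'"
  using is_dual_exists is_dual_unique by metis

lemma ordered_tree_append_child:
  assumes T: "ordered_tree T" and u: "u \<in> verts T" and v: "v \<notin> verts T"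
  shows "ordered_tree (append_child T u v)" (is "ordered_tree ?S")
proof -
  have c: "children ?S w = (if w = u then children T u @ [v] else children T w)" for w
    by (simp add: append_child_def)
  have V: "verts ?S = insert v (verts T)" "root ?S = root T" by (simp_all add: append_child_def)
  have vc: "v \<notin> set (children T w)" for w using ordered_treeD(5)[OF T] v by blast
  have "edges T \<subseteq> edges ?S" by (auto simp: edges_def c)
  then have E: "(edges T)\<^sup>* \<subseteq> (edges ?S)\<^sup>*" by (rule rtrancl_mono)
  have uv: "(u, v) \<in> edges ?S" by (simp add: edges_def c)
  show ?thesis
    unfolding ordered_tree_def
  proof (intro conjI allI ballI impI)
    show "finite (verts ?S)" "root ?S \<in> verts ?S"
      using ordered_treeD(1,2)[OF T] V by auto
    show "children ?S w = []" if "w \<notin> verts ?S" for w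
      using that ordered_treeD(3)[OF T] V u by (auto simp: c)
    show "distinct (children ?S w)" for w
      using ordered_treeD(4)[OF T] vc by (simp add: c)
    show "set (children ?S w) \<subseteq> verts ?S" for w
      using ordered_treeD(5)[OF T] V by (auto simp: c)
    show "root ?S \<notin> set (children ?S w)" for w
      using ordered_treeD(2,5)[OF T] V v by (auto simp: c)
    show "\<exists>!p. w \<in> set (children ?S p)" if w: "w \<in> verts ?S - {root ?S}" for w
    proof (cases "w = v")
      case True
      then show ?thesis using vc by (auto simp: c)
    next
      case False
      then obtain p where p: "w \<in> set (children T p)"
        using ordered_treeD(7)[OF T] w V by auto
      have "w \<in> set (children ?S q) \<longleftrightarrow> w \<in> set (children T q)" for q
        using False by (simp add: c)
      then show ?thesis using p ordered_treeD(6)[OF T] by metis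
    qed
    show "(root ?S, w) \<in> (edges ?S)\<^sup>*" if w: "w \<in> verts ?S" for w
      using ordered_treeD(8)[OF T] w V u E uv
      by (metis insertE rtrancl.rtrancl_into_rtrancl subsetD)
  qed
qed

lemma attach_point_in:
  "attach_point A m \<in> insert None ((\<lambda>k. Some (A ! k)) ` {..<m})"
proof (cases "\<exists>k<m. A ! k < A ! m")
  case True
  then obtain k where "k < m \<and> A ! k < A ! m" by blast
  then have "(GREATEST k. k < m \<and> A ! k < A ! m) < m"
    using GreatestI_nat[of "\<lambda>k. k < m \<and> A ! k < A ! m" k m] by auto
  then show ?thesis using True by (auto simp: attach_point_def)
next
  case False
  then have "attach_point A m = None" unfolding attach_point_def by argo
  then show ?thesis by simp
qed

lemma heap_upto:
  assumes "distinct A" "m \<le> length A"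
  shows "ordered_tree (heap_upto A m) \<and> root (heap_upto A m) = None \<and>
    verts (heap_upto A m) = insert None ((\<lambda>k. Some (A ! k)) ` {..<m})"
  using assms(2)
proof (induction m)
  case 0
  then show ?case by (simp add: ordered_tree_def)
next
  case (Suc m)
  have "Some (A ! m) \<notin> verts (heap_upto A m)"
    using Suc assms(1) by (auto simp: nth_eq_iff_index_eq)
  then have "ordered_tree (heap_upto A (Suc m))"
    using Suc attach_point_in[of A m]
      ordered_tree_append_child[of "heap_upto A m" "attach_point A m" "Some (A ! m)"]
    by simp
  moreover have "root (heap_upto A (Suc m)) = None"
    "verts (heap_upto A (Suc m)) = insert None ((\<lambda>k. Some (A ! k)) ` {..<Suc m})"
    using Suc by (auto simp: append_child_def lessThan_Suc)
  ultimately show ?case by blast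
qed

lemma ordered_tree_min_heap: "distinct A \<Longrightarrow> ordered_tree (min_heap A)"
  using heap_upto[of A "length A"] by (simp add: min_heap_def)

end

theory Submission
  imports Defs
begin

text \<open>
  In index terms, \<open>A ! j\<close> is the rightmost child of \<open>A ! k\<close> iff \<open>k < j\<close> is the position of the
  previous value smaller than \<open>A ! j\<close> and the next value smaller than \<open>A ! j\<close>, if there is one,
  is even smaller than \<open>A ! k\<close>. The immediate left sibling relation has exactly the mirror image of
  this description, so reversing the array exchanges the two relations. The rightmost child of the
  root is the minimum of \<open>A\<close>, which does not depend on the order of the entries.
\<close>

section \<open>Sibling relations in terms of attachment points\<close>

lemma last_filter_upt_iff:
  "filter P [0..<n] \<noteq> [] \<and> j = last (filter P [0..<n]) \<longleftrightarrow>
     j < n \<and> P j \<and> (\<forall>i. j < i \<and> i < n \<longrightarrow> \<not> P i)" (is "?L \<longleftrightarrow> ?R")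
proof
  assume ?L
  then obtain xs where xs: "filter P [0..<n] = xs @ [j]"
    by (metis append_butlast_last_id)
  have "sorted (filter P [0..<n])" by (simp add: sorted_wrt_filter)
  moreover have "set (filter P [0..<n]) = {i. i < n \<and> P i}" by auto
  ultimately have "sorted (xs @ [j])" "set (xs @ [j]) = {i. i < n \<and> P i}"
    unfolding xs by blast+
  moreover from this have "i \<in> set (xs @ [j])" if "i < n" "P i" for i using that by blast
  ultimately show ?R by (fastforce simp: sorted_append)
next
  assume R: ?R
  then have "[0..<n] = [0..<j] @ j # [Suc j..<n]"
    by (metis less_imp_le_nat upt_add_eq_append upt_conv_Cons zero_le le_add_diff_inverse)
  moreover have "filter P [Suc j..<n] = []" using R by (auto simp: filter_empty_conv)
  ultimately have "filter P [0..<n] = filter P [0..<j] @ [j]" using R by simp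
  then show ?L by simp
qed

lemma consecutive_filter_upt_iff:
  "(\<exists>xs ys. filter P [0..<n] = xs @ j # k # ys) \<longleftrightarrow>
     j < k \<and> k < n \<and> P j \<and> P k \<and> (\<forall>i. j < i \<and> i < k \<longrightarrow> \<not> P i)" (is "?L \<longleftrightarrow> ?R")
proof
  assume ?L
  then obtain xs ys where xs: "filter P [0..<n] = xs @ j # k # ys" by blast
  have "sorted_wrt (<) (filter P [0..<n])" by (simp add: sorted_wrt_filter)
  moreover have "set (filter P [0..<n]) = {i. i < n \<and> P i}" by auto
  ultimately have s: "sorted_wrt (<) (xs @ j # k # ys)"
    and e: "set (xs @ j # k # ys) = {i. i < n \<and> P i}"
    unfolding xs by blast+
  have "\<not> P i" if "j < i" "i < k" for i
  proof
    assume "P i"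
    moreover have "k < n" using e by auto
    ultimately have "i \<in> set (xs @ j # k # ys)" using e that by auto
    then show False using s that by (auto simp: sorted_wrt_append)
  qed
  moreover have "j < k" using s by (auto simp: sorted_wrt_append)
  moreover have "k < n" "P j" "P k" using e by auto
  ultimately show ?R by blast
next
  assume R: ?R
  have "[0..<n] = [0..<j] @ [j..<k] @ [k..<n]"
    using R upt_add_eq_append[of 0 j "n - j"] upt_add_eq_append[of j k "n - k"] by simp
  also have "\<dots> = [0..<j] @ (j # [Suc j..<k]) @ k # [Suc k..<n]"
    using R by (simp add: upt_conv_Cons)
  finally have "[0..<n] = [0..<j] @ (j # [Suc j..<k]) @ k # [Suc k..<n]" .
  moreover have "filter P [Suc j..<k] = []" using R by (auto simp: filter_empty_conv)
  ultimately have "filter P [0..<n] = filter P [0..<j] @ j # k # filter P [Suc k..<n]"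
    using R by simp
  then show ?L by blast
qed

text \<open>Entries are inserted by increasing index and always as rightmost child, so sibling order
  is index order and the children of \<open>u\<close> form a filtered index range.\<close>

lemma children_heap_upto:
  "children (heap_upto A m) u = map (\<lambda>j. Some (A ! j)) (filter (\<lambda>j. attach_point A j = u) [0..<m])"
  by (induction m) (auto simp: append_child_def)

lemma rmc_min_heap_iff:
  "rmc (min_heap A) u v \<longleftrightarrow>
     (\<exists>j < length A. v = Some (A ! j) \<and> attach_point A j = u \<and>
        (\<forall>i. j < i \<and> i < length A \<longrightarrow> attach_point A i \<noteq> u))"
proof -
  have "rmc (min_heap A) u v \<longleftrightarrow> (\<exists>j. v = Some (A ! j) \<and>
      filter (\<lambda>j. attach_point A j = u) [0..<length A] \<noteq> [] \<and>
      j = last (filter (\<lambda>j. attach_point A j = u) [0..<length A]))"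
    by (auto simp: rmc_def min_heap_def children_heap_upto last_map)
  then show ?thesis unfolding last_filter_upt_iff by blast
qed

lemma ils_min_heap_iff:
  "ils (min_heap A) u v \<longleftrightarrow>
     (\<exists>j k. j < k \<and> k < length A \<and> u = Some (A ! k) \<and> v = Some (A ! j) \<and>
        attach_point A j = attach_point A k \<and>
        (\<forall>i. j < i \<and> i < k \<longrightarrow> attach_point A i \<noteq> attach_point A k))" (is "_ \<longleftrightarrow> ?R")
proof -
  \<comment> \<open>Adjacency in a mapped list is pulled back to adjacency in the list of indices,
    where \<open>consecutive_filter_upt_iff\<close> applies.\<close>
  have "(\<exists>xs ys. map f l = xs @ b # a # ys) \<longleftrightarrow>
      (\<exists>j k. b = f j \<and> a = f k \<and> (\<exists>xs ys. l = xs @ j # k # ys))" (is "?L \<longleftrightarrow> ?M")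
    for f :: "nat \<Rightarrow> 'a option" and l a b
  proof
    assume ?L
    then obtain xs ys where "map f l = xs @ b # a # ys" by blast
    then obtain xs' zs where "l = xs' @ zs" "map f zs = b # a # ys"
      by (auto simp: map_eq_append_conv)
    then show ?M by (auto simp: map_eq_Cons_conv)
  next
    assume ?M
    then obtain j k xs ys where "b = f j" "a = f k" "l = xs @ j # k # ys" by blast
    then have "map f l = map f xs @ b # a # map f ys" by simp
    then show ?L by blast
  qed
  then have "ils (min_heap A) u v \<longleftrightarrow> (\<exists>w j k. v = Some (A ! j) \<and> u = Some (A ! k) \<and>
      (\<exists>xs ys. filter (\<lambda>j. attach_point A j = w) [0..<length A] = xs @ j # k # ys))"
    by (simp add: ils_def min_heap_def children_heap_upto)
  also have "\<dots> \<longleftrightarrow> (\<exists>j k. v = Some (A ! j) \<and> u = Some (A ! k) \<and> (\<exists>w. j < k \<and> k < length A \<and>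
      attach_point A k = w \<and> attach_point A j = w \<and>
      (\<forall>i. j < i \<and> i < k \<longrightarrow> attach_point A i \<noteq> w)))"
    unfolding consecutive_filter_upt_iff by blast
  also have "\<dots> \<longleftrightarrow> ?R" by (intro ex_cong1) auto
  finally show ?thesis .
qed

section \<open>Attachment points as nearest smaller entries to the left\<close>

lemma attach_point_None_iff:
  "attach_point A m = None \<longleftrightarrow> (\<forall>i < m. A ! m \<le> A ! i)"
proof -
  have "attach_point A m = None \<longleftrightarrow> \<not> (\<exists>i < m. A ! i < A ! m)"
    by (cases "\<exists>i < m. A ! i < A ! m")
      (simp_all only: attach_point_def if_True if_False option.distinct simp_thms)
  then show ?thesis unfolding not_less[symmetric] by blast
qed

text \<open>By maximality, no entry strictly between the attachment index and \<open>m\<close> is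
  below \<open>A ! m\<close>; distinctness makes these entries strictly larger.\<close>

lemma attach_point_Some_iff:
  assumes "distinct A" "m < length A"
  shows "attach_point A m = Some x \<longleftrightarrow>
    (\<exists>k < m. x = A ! k \<and> A ! k < A ! m \<and> (\<forall>i. k < i \<and> i < m \<longrightarrow> A ! m < A ! i))" (is "_ \<longleftrightarrow> ?R")
proof -
  let ?P = "\<lambda>k. k < m \<and> A ! k < A ! m"
  have neq: "A ! m \<noteq> A ! i" if "i < m" for i
    using assms that by (simp add: nth_eq_iff_index_eq)
  have greatest: "(GREATEST k. ?P k) = k \<longleftrightarrow> ?P k \<and> (\<forall>i. k < i \<and> i < m \<longrightarrow> A ! m < A ! i)"
    if ex: "\<exists>k. ?P k" for k
  proof
    assume k: "(GREATEST k. ?P k) = k"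
    have "?P k" using GreatestI_ex_nat[of ?P m] ex k by auto
    moreover have "A ! m < A ! i" if "k < i" "i < m" for i
      using Greatest_le_nat[of ?P i m] k that neq[of i] by (meson leD less_imp_le_nat linorder_neqE)
    ultimately show "?P k \<and> (\<forall>i. k < i \<and> i < m \<longrightarrow> A ! m < A ! i)" by blast
  next
    assume "?P k \<and> (\<forall>i. k < i \<and> i < m \<longrightarrow> A ! m < A ! i)"
    then show "(GREATEST k. ?P k) = k"
      by (intro Greatest_equality) (auto simp: not_le[symmetric] dest: leD intro: leI)
  qed
  show ?thesis
  proof (cases "\<exists>k. ?P k")
    case True
    then have "attach_point A m = Some (A ! (GREATEST k. ?P k))"
      by (auto simp: attach_point_def)
    then have "attach_point A m = Some x \<longleftrightarrow> (\<exists>k. (GREATEST k. ?P k) = k \<and> x = A ! k)" by auto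
    then show ?thesis unfolding greatest[OF True] by blast
  next
    case False
    then have "\<forall>i < m. A ! m \<le> A ! i" unfolding not_less[symmetric] by blast
    then have "attach_point A m = None" unfolding attach_point_None_iff .
    moreover have "\<not> ?R" using False by blast
    ultimately show ?thesis by simp
  qed
qed

section \<open>Rightmost children and immediate left siblings in terms of indices\<close>

lemma ex_first_less:
  assumes "j < i" "(A :: 'a::linorder list) ! i < b"
  obtains i' where "j < i'" "i' \<le> i" "A ! i' < b" "\<And>l. j < l \<Longrightarrow> l < i' \<Longrightarrow> b \<le> A ! l"
proof -
  let ?P = "\<lambda>i. j < i \<and> A ! i < b"
  have "?P (LEAST i. ?P i)" using assms by (intro LeastI[of ?P i]) simp
  moreover have "(LEAST i. ?P i) \<le> i" using assms by (intro Least_le) simp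
  moreover have "b \<le> A ! l" if "j < l" "l < (LEAST i. ?P i)" for l
    using not_less_Least[OF that(2)] that(1) by auto
  ultimately show ?thesis using that by blast
qed

lemma rmc_root_min_heap_iff:
  "rmc (min_heap A) None v \<longleftrightarrow> (\<exists>x \<in> set A. v = Some x \<and> (\<forall>y \<in> set A. x \<le> y))" if "distinct A"
proof
  assume "rmc (min_heap A) None v"
  then obtain j where j: "j < length A" "v = Some (A ! j)" "\<forall>i < j. A ! j \<le> A ! i"
    and last: "\<And>i. j < i \<Longrightarrow> i < length A \<Longrightarrow> \<exists>l < i. A ! l < A ! i"
    unfolding rmc_min_heap_iff attach_point_None_iff by (auto simp: not_le)
  have "A ! j \<le> A ! i" if i: "i < length A" for i
  proof (rule ccontr)
    assume "\<not> A ! j \<le> A ! i"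
    then have less: "A ! i < A ! j" by simp
    then have "j < i" using j(3) by (metis leD linorder_neqE_nat order.irrefl)
    \<comment> \<open>The first entry below \<open>A ! j\<close> after \<open>j\<close> would be
      smaller than everything before it, hence a child of the root to the right of
      \<open>A ! j\<close>.\<close>
    then obtain i' where i': "j < i'" "i' \<le> i" "A ! i' < A ! j"
      "\<And>l. j < l \<Longrightarrow> l < i' \<Longrightarrow> A ! j \<le> A ! l"
      using ex_first_less less by blast
    then obtain l where l: "l < i'" "A ! l < A ! i'" using last i by force
    then have "A ! l < A ! j" using i'(3) by simp
    then show False using j(3) i'(4) l(1) by (metis leD linorder_neqE_nat order.irrefl)
  qed
  then show "\<exists>x \<in> set A. v = Some x \<and> (\<forall>y \<in> set A. x \<le> y)"
    using j by (auto simp: in_set_conv_nth)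
next
  assume "\<exists>x \<in> set A. v = Some x \<and> (\<forall>y \<in> set A. x \<le> y)"
  then obtain j where j: "j < length A" "v = Some (A ! j)" "\<And>i. i < length A \<Longrightarrow> A ! j \<le> A ! i"
    by (metis in_set_conv_nth)
  moreover have "A ! j < A ! i" if "j < i" "i < length A" for i
    using j(1) j(3)[of i] that \<open>distinct A\<close> by (simp add: order_less_le nth_eq_iff_index_eq)
  ultimately show "rmc (min_heap A) None v"
    unfolding rmc_min_heap_iff attach_point_None_iff by (force simp: not_le)
qed

text \<open>The last conjunct says that the first entry after \<open>j\<close> below
  \<open>A ! j\<close>, if any, is below \<open>A ! k\<close> as well: for that \<open>i\<close>,
  the witness \<open>l\<close> can only be \<open>i\<close> itself. This form avoids naming the
  first index and is vacuous if there is none.\<close>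

definition rmc_indices :: "'a::linorder list \<Rightarrow> nat \<Rightarrow> nat \<Rightarrow> bool" where
  "rmc_indices A k j \<longleftrightarrow> k < j \<and> j < length A \<and> A ! k < A ! j \<and>
     (\<forall>i. k < i \<and> i < j \<longrightarrow> A ! j < A ! i) \<and>
     (\<forall>i. j < i \<and> i < length A \<and> A ! i < A ! j \<longrightarrow> (\<exists>l. j < l \<and> l \<le> i \<and> A ! l < A ! k))"

text \<open>The conjuncts of \<open>rmc_indices\<close> reflected. The argument order makes the
  parent \<open>k\<close> there correspond to the right sibling \<open>k\<close> here, as in the
  dual tree.\<close>

definition ils_indices :: "'a::linorder list \<Rightarrow> nat \<Rightarrow> nat \<Rightarrow> bool" where
  "ils_indices A k j \<longleftrightarrow> j < k \<and> k < length A \<and> A ! k < A ! j \<and>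
     (\<forall>i. j < i \<and> i < k \<longrightarrow> A ! j < A ! i) \<and>
     (\<forall>i. i < j \<and> A ! i < A ! j \<longrightarrow> (\<exists>l. i \<le> l \<and> l < j \<and> A ! l < A ! k))"

lemma rmc_iff_rmc_indices:
  assumes "distinct A"
  shows "rmc (min_heap A) (Some x) v \<longleftrightarrow>
    (\<exists>k j. x = A ! k \<and> v = Some (A ! j) \<and> rmc_indices A k j)"
proof
  assume "rmc (min_heap A) (Some x) v"
  then obtain j where j: "j < length A" "v = Some (A ! j)" "attach_point A j = Some x"
    and last: "\<And>i. j < i \<Longrightarrow> i < length A \<Longrightarrow> attach_point A i \<noteq> Some x"
    unfolding rmc_min_heap_iff by blast
  obtain k where k: "k < j" "x = A ! k" "A ! k < A ! j" "\<And>i. k < i \<Longrightarrow> i < j \<Longrightarrow> A ! j < A ! i"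
    using j(3) attach_point_Some_iff[OF assms j(1)] by blast
  have "\<exists>l. j < l \<and> l \<le> i \<and> A ! l < A ! k" if i: "j < i" "i < length A" "A ! i < A ! j" for i
  proof -
    \<comment> \<open>The first entry after \<open>j\<close> below \<open>A ! j\<close> is below
      everything strictly between \<open>k\<close> and itself. Were it above \<open>A ! k\<close>,
      it would be a child of \<open>A ! k\<close> to the right of \<open>A ! j\<close>.\<close>
    obtain i' where i': "j < i'" "i' \<le> i" "A ! i' < A ! j"
      "\<And>l. j < l \<Longrightarrow> l < i' \<Longrightarrow> A ! j \<le> A ! l"
      using ex_first_less i by blast
    have "A ! i' < A ! l" if "k < l" "l < i'" for l
      using i'(3) i'(4)[of l] k(4)[of l] that by (cases l j rule: linorder_cases) auto
    moreover have "attach_point A i' \<noteq> Some x" "i' < length A" "k < i'"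
      using last[of i'] i i' k by auto
    ultimately have "\<not> A ! k < A ! i'"
      using attach_point_Some_iff[OF assms, of i' x] k(2) by blast
    moreover have "A ! k \<noteq> A ! i'" using assms k i' i by (simp add: nth_eq_iff_index_eq)
    ultimately show ?thesis using i' by force
  qed
  then have "rmc_indices A k j" using j k unfolding rmc_indices_def by blast
  then show "\<exists>k j. x = A ! k \<and> v = Some (A ! j) \<and> rmc_indices A k j" using j k by blast
next
  assume "\<exists>k j. x = A ! k \<and> v = Some (A ! j) \<and> rmc_indices A k j"
  then obtain k j where x: "x = A ! k" "v = Some (A ! j)"
    and kj: "k < j" "j < length A" "A ! k < A ! j" "\<And>i. k < i \<Longrightarrow> i < j \<Longrightarrow> A ! j < A ! i"
    and next': "\<And>i. j < i \<Longrightarrow> i < length A \<Longrightarrow> A ! i < A ! j \<Longrightarrow> \<exists>l. j < l \<and> l \<le> i \<and> A ! l < A ! k"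
    unfolding rmc_indices_def by blast
  have "attach_point A j = Some x" using attach_point_Some_iff[OF assms kj(2)] kj x by blast
  moreover have "attach_point A i \<noteq> Some x" if i: "j < i" "i < length A" for i
  proof
    assume "attach_point A i = Some x"
    then obtain k' where k': "k' < i" "x = A ! k'" "A ! k' < A ! i"
      "\<And>l. k' < l \<Longrightarrow> l < i \<Longrightarrow> A ! i < A ! l"
      using attach_point_Some_iff[OF assms i(2)] by blast
    have "k' = k" using x k' assms i kj by (simp add: nth_eq_iff_index_eq)
    \<comment> \<open>A later child of \<open>A ! k\<close> is below \<open>A ! j\<close>, so
      \<open>next'\<close> puts an entry below \<open>A ! k\<close> after \<open>j\<close> and no
      later than \<open>i\<close>. But all entries after \<open>k\<close> up to \<open>i\<close>
      exceed \<open>A ! k\<close>.\<close>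
    moreover from this have "A ! i < A ! j" using k'(4) kj(1) i by blast
    ultimately obtain l where "j < l" "l \<le> i" "A ! l < A ! k" using next' i by blast
    then show False using k' \<open>k' = k\<close> kj(1)
      by (metis le_neq_implies_less less_trans not_less_iff_gr_or_eq)
  qed
  ultimately show "rmc (min_heap A) (Some x) v"
    unfolding rmc_min_heap_iff using x kj by blast
qed

lemma ils_iff_ils_indices:
  assumes "distinct A"
  shows "ils (min_heap A) u v \<longleftrightarrow>
    (\<exists>k j. u = Some (A ! k) \<and> v = Some (A ! j) \<and> ils_indices A k j)"
proof
  assume "ils (min_heap A) u v"
  then obtain j k where jk: "j < k" "k < length A" "u = Some (A ! k)" "v = Some (A ! j)"
    and eq: "attach_point A j = attach_point A k"
    and between: "\<And>i. j < i \<Longrightarrow> i < k \<Longrightarrow> attach_point A i \<noteq> attach_point A k"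
    unfolding ils_min_heap_iff by blast
  have neq: "A ! i \<noteq> A ! l" if "i < l" "l \<le> k" for i l
    using assms that jk by (simp add: nth_eq_iff_index_eq)
  \<comment> \<open>The nearest smaller entry of \<open>A ! k\<close> is the common parent, which
    lies to the left of \<open>j\<close>, or does not exist if the parent is the root.\<close>
  have greater: "A ! k < A ! i" if i: "j \<le> i" "i < k" for i
  proof (cases "attach_point A k")
    case None
    then show ?thesis using attach_point_None_iff[of A k] i neq[of i k] by force
  next
    case (Some x)
    then obtain p where p: "p < k" "x = A ! p" "\<And>i. p < i \<Longrightarrow> i < k \<Longrightarrow> A ! k < A ! i"
      using attach_point_Some_iff[OF assms jk(2)] by blast
    obtain q where "q < j" "x = A ! q"
      using attach_point_Some_iff[OF assms, of j x] Some eq jk by auto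
    moreover from this have "q = p" using p assms jk by (simp add: nth_eq_iff_index_eq)
    ultimately show ?thesis using p i by simp
  qed
  have "A ! j < A ! i" if i: "j < i" "i < k" for i
  proof (rule ccontr)
    assume "\<not> A ! j < A ! i"
    then have "A ! i < A ! j" using neq[of j i] i by simp
    \<comment> \<open>The first entry between \<open>j\<close> and \<open>k\<close> below
      \<open>A ! j\<close> still exceeds \<open>A ! k\<close>, so it attaches where
      \<open>A ! j\<close> does and would be a sibling strictly between the two.\<close>
    then obtain i' where i': "j < i'" "i' \<le> i" "A ! i' < A ! j"
      "\<And>l. j < l \<Longrightarrow> l < i' \<Longrightarrow> A ! j \<le> A ! l"
      using ex_first_less i by blast
    have ge: "A ! i' < A ! l" if "j \<le> l" "l < i'" for l
      using that i'(3) i'(4)[of l] by (cases "l = j") auto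
    have "attach_point A i' = attach_point A j"
    proof (cases "attach_point A j")
      case None
      have "A ! i' \<le> A ! l" if "l < i'" for l
        using that ge[of l] i'(3) None attach_point_None_iff[of A j]
        by (cases "l < j") force+
      then show ?thesis using None attach_point_None_iff[of A i'] by simp
    next
      case (Some x)
      then obtain p where p: "p < j" "x = A ! p" "\<And>i. p < i \<Longrightarrow> i < j \<Longrightarrow> A ! j < A ! i"
        using attach_point_Some_iff[OF assms, of j x] jk by auto
      have "A ! p < A ! k"
        using attach_point_Some_iff[OF assms, of k x] Some eq p jk by auto
      also have "A ! k < A ! i'" using greater i' i by simp
      finally have "A ! p < A ! i'" .
      moreover have "A ! i' < A ! l" if "p < l" "l < i'" for l
        using that ge[of l] i'(3) p(3)[of l] by (cases "l < j") auto
      moreover have "p < i'" "i' < length A" using p i' i jk by auto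
      ultimately have "attach_point A i' = Some x"
        using attach_point_Some_iff[OF assms, of i' x] p(2) by blast
      then show ?thesis using Some by simp
    qed
    then show False using between[of i'] i' i eq by simp
  qed
  \<comment> \<open>The witness is the position of the common parent: it is the last position before
    \<open>j\<close> with a smaller entry, so \<open>i\<close> is not beyond it. Below the root
    there is no such \<open>i\<close>.\<close>
  moreover have "\<exists>l. i \<le> l \<and> l < j \<and> A ! l < A ! k" if i: "i < j" "A ! i < A ! j" for i
  proof (cases "attach_point A j")
    case None
    then show ?thesis using attach_point_None_iff[of A j] i by force
  next
    case (Some x)
    then obtain p where p: "p < j" "x = A ! p" "\<And>i. p < i \<Longrightarrow> i < j \<Longrightarrow> A ! j < A ! i"
      using attach_point_Some_iff[OF assms, of j x] jk by auto
    have "A ! p < A ! k"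
      using attach_point_Some_iff[OF assms, of k x] Some eq p jk by auto
    moreover have "i \<le> p" using p(3)[of i] i by force
    ultimately show ?thesis using p by blast
  qed
  ultimately have "ils_indices A k j" using jk greater[of j] unfolding ils_indices_def by blast
  then show "\<exists>k j. u = Some (A ! k) \<and> v = Some (A ! j) \<and> ils_indices A k j" using jk by blast
next
  assume "\<exists>k j. u = Some (A ! k) \<and> v = Some (A ! j) \<and> ils_indices A k j"
  then obtain k j where uv: "u = Some (A ! k)" "v = Some (A ! j)"
    and jk: "j < k" "k < length A" "A ! k < A ! j" "\<And>i. j < i \<Longrightarrow> i < k \<Longrightarrow> A ! j < A ! i"
    and prev: "\<And>i. i < j \<Longrightarrow> A ! i < A ! j \<Longrightarrow> \<exists>l. i \<le> l \<and> l < j \<and> A ! l < A ! k"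
    unfolding ils_indices_def by blast
  have neq: "A ! i \<noteq> A ! l" if "i < l" "l \<le> k" for i l
    using assms that jk by (simp add: nth_eq_iff_index_eq)
  have greater: "A ! k < A ! i" if "j \<le> i" "i < k" for i
    using that jk(3) jk(4)[of i] by (cases "i = j") auto
  \<comment> \<open>The nearest smaller position \<open>p\<close> of \<open>k\<close> lies before
    \<open>j\<close>, since all entries from \<open>j\<close> on exceed \<open>A ! k\<close>. An
    entry below \<open>A ! j\<close> between \<open>p\<close> and \<open>j\<close> would, by
    \<open>prev\<close>, give one below \<open>A ! k\<close> after \<open>p\<close>.\<close>
  have eq: "attach_point A j = attach_point A k"
  proof (cases "attach_point A k")
    case None
    then have "A ! k \<le> A ! l" if "l < k" for l
      using that attach_point_None_iff[of A k] by blast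
    then have "A ! j \<le> A ! i" if "i < j" for i
      using prev[OF that] jk(1) by (meson leD leI less_trans)
    then show ?thesis using None attach_point_None_iff[of A j] by simp
  next
    case (Some x)
    then obtain p where p: "p < k" "x = A ! p" "A ! p < A ! k"
      "\<And>i. p < i \<Longrightarrow> i < k \<Longrightarrow> A ! k < A ! i"
      using attach_point_Some_iff[OF assms jk(2)] by blast
    have "p < j" using greater[of p] p by force
    moreover have "A ! j < A ! i" if i: "p < i" "i < j" for i
    proof (rule ccontr)
      assume "\<not> A ! j < A ! i"
      then have "A ! i < A ! j" using neq[of i j] i jk by simp
      then obtain l where "i \<le> l" "l < j" "A ! l < A ! k" using prev i by blast
      then show False using p(4)[of l] i jk by simp
    qed
    moreover have "A ! p < A ! j" "j < length A" using p jk by auto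
    ultimately have "attach_point A j = Some x"
      using attach_point_Some_iff[OF assms, of j x] p(2) by blast
    then show ?thesis using Some by simp
  qed
  \<comment> \<open>Entries strictly between \<open>j\<close> and \<open>k\<close> exceed
    \<open>A ! j\<close>, so their nearest smaller entry is at \<open>j\<close> or later, whereas
    the parent of \<open>A ! j\<close> is the root or lies before \<open>j\<close>.\<close>
  have "attach_point A i \<noteq> attach_point A j" if i: "j < i" "i < k" for i
  proof
    assume eq': "attach_point A i = attach_point A j"
    have less: "A ! j < A ! i" using jk(4) i .
    then obtain x where x: "attach_point A i = Some x"
      using attach_point_None_iff[of A i] i by (cases "attach_point A i") force+
    obtain p where p: "p < i" "x = A ! p" "\<And>l. p < l \<Longrightarrow> l < i \<Longrightarrow> A ! i < A ! l"
      using x attach_point_Some_iff[OF assms, of i x] i jk by auto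
    obtain q where q: "q < j" "x = A ! q"
      using x eq' attach_point_Some_iff[OF assms, of j x] jk by auto
    have "p = q" using p q assms i jk by (simp add: nth_eq_iff_index_eq)
    then show False using p(3)[of j] q i less by simp
  qed
  then show "ils (min_heap A) u v"
    unfolding ils_min_heap_iff using uv jk eq by metis
qed

section \<open>Reversing the array\<close>

lemma ils_indices_if_rmc_indices_rev:
  assumes "rmc_indices (rev A) k j"
  shows "ils_indices A (length A - Suc k) (length A - Suc j)"
proof -
  let ?f = "\<lambda>i. length A - Suc i"
  have f: "rev A ! ?f i = A ! i" if "i < length A" for i
    using that by (simp add: rev_nth)
  have kj: "k < j" "j < length A" "A ! ?f k < A ! ?f j"
    and between: "\<And>i. k < i \<Longrightarrow> i < j \<Longrightarrow> A ! ?f j < rev A ! i"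
    and last: "\<And>i. j < i \<Longrightarrow> i < length A \<Longrightarrow> rev A ! i < A ! ?f j \<Longrightarrow>
      \<exists>l. j < l \<and> l \<le> i \<and> rev A ! l < A ! ?f k"
    using assms unfolding rmc_indices_def by (auto simp: rev_nth)
  have "A ! ?f j < A ! i" if "?f j < i" "i < ?f k" for i
    using between[of "?f i"] f[of i] that kj by simp
  moreover have "\<exists>l. i \<le> l \<and> l < ?f j \<and> A ! l < A ! ?f k" if i: "i < ?f j" "A ! i < A ! ?f j" for i
  proof -
    \<comment> \<open>Reflection undoes itself on valid indices; natural subtraction truncates,
      hence the explicit bounds.\<close>
    have "j < ?f i" "?f i < length A" "i < length A" using i kj(2) by auto
    then obtain l where "j < l" "l \<le> ?f i" "rev A ! l < A ! ?f k"
      using last[of "?f i"] f[of i] i by auto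
    then show ?thesis using i by (intro exI[of _ "?f l"]) (auto simp: rev_nth)
  qed
  ultimately show ?thesis using kj unfolding ils_indices_def by auto
qed

lemma rmc_indices_rev_if_ils_indices:
  assumes "ils_indices A k j"
  shows "rmc_indices (rev A) (length A - Suc k) (length A - Suc j)"
proof -
  let ?f = "\<lambda>i. length A - Suc i"
  have f: "rev A ! ?f i = A ! i" if "i < length A" for i
    using that by (simp add: rev_nth)
  have jk: "j < k" "k < length A" "A ! k < A ! j"
    and between: "\<And>i. j < i \<Longrightarrow> i < k \<Longrightarrow> A ! j < A ! i"
    and first: "\<And>i. i < j \<Longrightarrow> A ! i < A ! j \<Longrightarrow> \<exists>l. i \<le> l \<and> l < j \<and> A ! l < A ! k"
    using assms unfolding ils_indices_def by auto
  have "A ! j < rev A ! i" if "?f k < i" "i < ?f j" for i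
    using between[of "?f i"] that jk by (simp add: rev_nth)
  moreover have "\<exists>l. ?f j < l \<and> l \<le> i \<and> rev A ! l < A ! k"
    if i: "?f j < i" "i < length A" "rev A ! i < A ! j" for i
  proof -
    have "?f i < j" using i jk by simp
    then obtain l where "?f i \<le> l" "l < j" "A ! l < A ! k"
      using first[of "?f i"] i by (auto simp: rev_nth)
    then show ?thesis using i jk f[of l] by (intro exI[of _ "?f l"]) auto
  qed
  ultimately show ?thesis using jk f unfolding rmc_indices_def by auto
qed

text \<open>Instantiated with \<open>A\<close> this yields the left sibling condition of
  \<open>is_dual\<close>, and with \<open>rev A\<close>, as reversal is an involution, the condition
  on rightmost children of non-root vertices.\<close>

lemma rmc_rev_iff_ils:
  assumes "distinct A"
  shows "rmc (min_heap (rev A)) (Some x) v \<longleftrightarrow> ils (min_heap A) (Some x) v"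
proof
  assume "rmc (min_heap (rev A)) (Some x) v"
  then obtain k j where "x = rev A ! k" "v = Some (rev A ! j)" "rmc_indices (rev A) k j"
    using rmc_iff_rmc_indices[of "rev A"] assms by auto
  moreover from this have "k < length A" "j < length A" by (auto simp: rmc_indices_def)
  ultimately show "ils (min_heap A) (Some x) v"
    using ils_indices_if_rmc_indices_rev[of A k j] ils_iff_ils_indices[OF assms]
    by (auto simp: rev_nth)
next
  assume "ils (min_heap A) (Some x) v"
  then obtain k j where "x = A ! k" "v = Some (A ! j)" and kj: "ils_indices A k j"
    using ils_iff_ils_indices[OF assms] by auto
  moreover from kj have "k < length A" "j < length A" by (auto simp: ils_indices_def)
  ultimately have "x = rev A ! (length A - Suc k)" "v = Some (rev A ! (length A - Suc j))"
    by (auto simp: rev_nth)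
  then show "rmc (min_heap (rev A)) (Some x) v"
    using rmc_indices_rev_if_ils_indices[OF kj] rmc_iff_rmc_indices[of "rev A"] assms by auto
qed

theorem theorem3:
  fixes A :: "'a::linorder list"
  assumes "distinct A"
  shows "dual (min_heap A) = min_heap (rev A)"
proof -
  have rev: "distinct (rev A)" using assms by simp
  have root: "root (min_heap B) = None" "verts (min_heap B) = insert None (Some ` set B)"
    if "distinct B" for B :: "'a list"
    using heap_upto[OF that, of "length B"] unfolding min_heap_def
    by (auto simp: set_conv_nth)
  have "is_dual (min_heap A) (min_heap (rev A))"
    unfolding is_dual_def
  proof (intro conjI allI impI)
    show "ordered_tree (min_heap (rev A))" using ordered_tree_min_heap[OF rev] .
    show "verts (min_heap (rev A)) = verts (min_heap A)"
      and "root (min_heap (rev A)) = root (min_heap A)"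
      using root[OF assms] root[OF rev] by auto
    show "rmc (min_heap (rev A)) (root (min_heap A)) v"
      if "rmc (min_heap A) (root (min_heap A)) v" for v
      using that root[OF assms] rmc_root_min_heap_iff[OF assms] rmc_root_min_heap_iff[OF rev]
      by simp
    show "ils (min_heap (rev A)) u v" if "u \<noteq> root (min_heap A) \<and> rmc (min_heap A) u v" for u v
      using that root[OF assms] rmc_rev_iff_ils[OF rev] by (cases u) auto
    \<comment> \<open>The case \<open>u = None\<close> is vacuous, since only array entries have a
      left sibling.\<close>
    show "rmc (min_heap (rev A)) u v" if "ils (min_heap A) u v" for u v
      using that rmc_rev_iff_ils[OF assms] by (cases u) (auto simp: ils_min_heap_iff)
  qed
  \<comment> \<open>\<open>dual\<close> is a definite description, so being some dual suffices once
    the dual is known to be unique.\<close>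
  then show ?thesis
    unfolding dual_def
    using ex1_is_dual[OF ordered_tree_min_heap[OF assms]] by (rule the1_equality[rotated])
qed

end
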